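(* Let $\mathbf{G}$ be a finite abelian group, let $A\subseteq\mathbf{G}$ be a nonempty set, and let $\psi:\mathbf{G}\to\mathbb{C}$ be a symmetric function (that is, $\psi(-x)=\psi(x)$ for all $x$) such that $\widehat{\psi}\ge 0$. Then $$\sum_{x,y,z\in A}\psi(x-y)\,\overline{\psi(x-z)}\,\psi(y-z)\ \ge\ \max\left\{\frac{1}{|A|^3}\left(\sum_{x}\psi(x)(A\circ A)(x)\right)^3,\ |\psi(0)|^3\,|A|,\ \frac{1}{|A|^{1/2}}\left(\sum_x|\psi(x)|^2(A\circ A)(x)\right)^{3/2}\right\},$$ where the inner sums are over $x\in\mathbf{G}$.
   Context: For a finite abelian group $\mathbf{G}$, $\widehat{\psi}(\xi)=\sum_{x\in\mathbf{G}}\psi(x)\overline{\xi(x)}$, where $\xi$ runs over the characters of $\mathbf{G}$; $\widehat\psi\ge0$ means that all values are real and nonnegative. $(A\circ A)(x)=|\{(a,a')\in A\times A: a'-a=x\}|$. *)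

theory Defs
  imports Complex_Main "HOL-Library.Nonpos_Ints"
begin

definition is_character :: "('a::ab_group_add \<Rightarrow> complex) \<Rightarrow> bool" where
  "is_character \<xi> \<longleftrightarrow> (\<forall>x y. \<xi> (x + y) = \<xi> x * \<xi> y) \<and> (\<forall>x. cmod (\<xi> x) = 1)"

definition fourier :: "('a::{finite,ab_group_add} \<Rightarrow> complex) \<Rightarrow> ('a \<Rightarrow> complex) \<Rightarrow> complex" where
  "fourier \<psi> \<xi> = (\<Sum>x\<in>UNIV. \<psi> x * cnj (\<xi> x))"

definition diff_count :: "'a::ab_group_add set \<Rightarrow> 'a \<Rightarrow> nat" where
  "diff_count A x = card {(a, a'). a \<in> A \<and> a' \<in> A \<and> a' - a = x}"

end

theory Submission
  imports Defs "HOL-Analysis.Convex"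
begin

text \<open>As \<open>\<psi>\<close> is symmetric with real transform, it is real; by Fourier inversion the matrix
  \<open>M = (\<psi> (x - y))\<close>, with \<open>x\<close> and \<open>y\<close> in \<open>A\<close>, is positive semidefinite, and the left side is
  \<open>tr M\<^sup>3\<close>. The spectral theorem is avoided: Cauchy-Schwarz for the positive semidefinite form
  \<open>(X, Y) \<mapsto> tr (X\<^sup>T M Y)\<close> on matrices, applied to \<open>I\<close> and \<open>M\<close>, gives
  \<open>(tr M\<^sup>2)\<^sup>2 \<le> tr M * tr M\<^sup>3\<close>, which together with \<open>(tr M)\<^sup>2 \<le> card A * tr M\<^sup>2\<close> yields the
  last two bounds. The first follows from the same argument for the all-ones vector \<open>e\<close>,
  which bounds \<open>e\<^sup>T M\<^sup>3 e\<close> from below, and from \<open>e\<^sup>T M\<^sup>3 e \<le> card A * tr M\<^sup>3\<close>.\<close>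

subsection \<open>Positive semidefinite kernels on a finite set\<close>

lemma quadratic_nonneg_imp_discrim:
  fixes a b c :: real
  assumes "\<And>t. 0 \<le> a + 2 * b * t + c * t\<^sup>2" and c: "0 \<le> c"
  shows "b\<^sup>2 \<le> a * c"
proof (cases "c = 0")
  case True
  have "b = 0"
  proof (rule ccontr)
    assume "b \<noteq> 0"
    \<comment> \<open>With \<open>c = 0\<close>, this \<open>t\<close> gives the expression the
      value \<open>a - (a + 1) = -1\<close>.\<close>
    with True assms(1)[of "- (a + 1) / (2 * b)"] show False by (simp add: field_simps)
  qed
  with True show ?thesis by simp
next
  case False
  with c have "c > 0" by simp
  have "0 \<le> c * (a + 2 * b * (- b / c) + c * (- b / c)\<^sup>2)"
    using c assms(1)[of "- b / c"] by (rule mult_nonneg_nonneg)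
  also have "\<dots> = a * c - b\<^sup>2"
    using \<open>c > 0\<close> by (simp add: field_simps power2_eq_square)
  finally show ?thesis by simp
qed

locale psd_kernel =
  fixes A :: "'a set" and M :: "'a \<Rightarrow> 'a \<Rightarrow> real"
  assumes finite: "finite A"
    and nonempty: "A \<noteq> {}"
    and sym: "M x y = M y x"
    and psd: "0 \<le> (\<Sum>x\<in>A. \<Sum>y\<in>A. u x * u y * M x y)"
begin

definition form :: "('a \<Rightarrow> real) \<Rightarrow> ('a \<Rightarrow> real) \<Rightarrow> real" where
  "form u v = (\<Sum>x\<in>A. \<Sum>y\<in>A. u x * v y * M x y)"

definition app :: "('a \<Rightarrow> real) \<Rightarrow> 'a \<Rightarrow> real" where
  "app u x = (\<Sum>y\<in>A. M x y * u y)"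

text \<open>By symmetry of \<open>M\<close>, \<open>tr1\<close>, \<open>tr2\<close> and
  \<open>tr3\<close> are the traces of the first three powers of \<open>M\<close>, restricted to
  \<open>A\<close>; \<open>tr3\<close> keeps the index pattern of the triple sum in the
  theorem.\<close>

definition tr1 :: real where "tr1 = (\<Sum>x\<in>A. M x x)"
definition tr2 :: real where "tr2 = (\<Sum>x\<in>A. \<Sum>y\<in>A. (M x y)\<^sup>2)"
definition tr3 :: real where "tr3 = (\<Sum>x\<in>A. \<Sum>y\<in>A. \<Sum>z\<in>A. M x y * M x z * M y z)"
definition entry_sum :: real where "entry_sum = (\<Sum>x\<in>A. \<Sum>y\<in>A. M x y)"

lemma form_nonneg: "0 \<le> form u u"
  unfolding form_def by (rule psd)

lemma form_sym: "form u v = form v u"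
  unfolding form_def by (subst sum.swap) (simp add: mult.commute sym)

lemma form_add_scaled:
  "form (\<lambda>x. u x + t * v x) (\<lambda>x. u x + t * v x) = form u u + 2 * form u v * t + form v v * t\<^sup>2"
proof -
  have "form (\<lambda>x. u x + t * v x) (\<lambda>x. u x + t * v x)
      = form u u + form u v * t + form v u * t + form v v * t\<^sup>2"
    unfolding form_def sum_distrib_right sum.distrib[symmetric]
    by (intro sum.cong refl) (simp add: algebra_simps power2_eq_square)
  thus ?thesis by (simp add: form_sym[of v u])
qed

text \<open>Summing \<open>form\<close> over \<open>I\<close> gives a positive semidefinite form on
  families of vectors. For \<open>I = A\<close> the families are the columns of two matrices; for a
  singleton this is the ordinary inequality.\<close>

lemma sum_form_Cauchy_Schwarz:
  "(\<Sum>z\<in>I. form (u z) (v z))\<^sup>2 \<le> (\<Sum>z\<in>I. form (u z) (u z)) * (\<Sum>z\<in>I. form (v z) (v z))"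
proof (rule quadratic_nonneg_imp_discrim)
  fix t :: real
  have "0 \<le> (\<Sum>z\<in>I. form (\<lambda>x. u z x + t * v z x) (\<lambda>x. u z x + t * v z x))"
    by (intro sum_nonneg form_nonneg)
  thus "0 \<le> (\<Sum>z\<in>I. form (u z) (u z)) + 2 * (\<Sum>z\<in>I. form (u z) (v z)) * t +
        (\<Sum>z\<in>I. form (v z) (v z)) * t\<^sup>2"
    by (simp add: form_add_scaled sum.distrib sum_distrib_left sum_distrib_right)
  show "0 \<le> (\<Sum>z\<in>I. form (v z) (v z))"
    by (intro sum_nonneg form_nonneg)
qed

lemma form_eq_app: "form u v = (\<Sum>x\<in>A. u x * app v x)"
  unfolding form_def app_def sum_distrib_left by (intro sum.cong refl) (simp add: mult_ac)

text \<open>The functions \<open>of_bool (x = z)\<close> are unit vectors, that is, the columns of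
  the identity matrix.\<close>

lemma app_delta: "z \<in> A \<Longrightarrow> app (\<lambda>x. of_bool (x = z)) x = M x z"
  unfolding app_def of_bool_def using finite by (simp add: if_distrib cong: if_cong)

lemma form_delta: "z \<in> A \<Longrightarrow> form (\<lambda>x. of_bool (x = z)) v = app v z"
  unfolding form_eq_app of_bool_def using finite by (simp add: if_distrib if_distribR cong: if_cong)

lemma tr3_eq_form: "tr3 = (\<Sum>z\<in>A. form (M z) (M z))"
  by (simp add: tr3_def form_def)

lemma tr2_eq_form: "tr2 = (\<Sum>z\<in>A. form (\<lambda>x. of_bool (x = z)) (M z))"
  unfolding tr2_def by (intro sum.cong refl) (simp add: form_delta app_def power2_eq_square)

lemma tr1_eq_form: "tr1 = (\<Sum>z\<in>A. form (\<lambda>x. of_bool (x = z)) (\<lambda>x. of_bool (x = z)))"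
  unfolding tr1_def by (intro sum.cong refl) (simp add: form_delta app_delta)

lemma tr3_nonneg: "0 \<le> tr3"
  unfolding tr3_eq_form by (intro sum_nonneg form_nonneg)

lemma tr1_nonneg: "0 \<le> tr1"
  unfolding tr1_eq_form by (intro sum_nonneg form_nonneg)

lemma tr2_nonneg: "0 \<le> tr2"
  unfolding tr2_def by (intro sum_nonneg) auto

section \<open>Lower bounds for the third trace by the first and second\<close>

lemma tr2_power2_le: "tr2\<^sup>2 \<le> tr1 * tr3"
  unfolding tr1_eq_form tr2_eq_form tr3_eq_form by (rule sum_form_Cauchy_Schwarz)

lemma card_pos: "0 < real (card A)"
  using finite nonempty by (simp add: card_gt_0_iff)

text \<open>Cauchy-Schwarz on the diagonal; the squared diagonal entries are among the summands of
  \<open>tr2\<close>.\<close>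

lemma tr1_power2_le: "tr1\<^sup>2 \<le> real (card A) * tr2"
proof -
  have "tr1\<^sup>2 \<le> (\<Sum>x\<in>A. 1\<^sup>2) * (\<Sum>x\<in>A. (M x x)\<^sup>2)"
    unfolding tr1_def using Cauchy_Schwarz_ineq_sum[of "\<lambda>_. 1" "\<lambda>x. M x x" A] by simp
  also have "\<dots> \<le> (\<Sum>x\<in>A. 1\<^sup>2) * tr2"
    unfolding tr2_def
    by (intro mult_left_mono sum_mono member_le_sum[where f = "\<lambda>y. (M _ y)\<^sup>2"] sum_nonneg)
       (auto simp: finite)
  finally show ?thesis by simp
qed

text \<open>With \<open>n = card A\<close>, eliminating \<open>tr2\<close> gives
  \<open>tr1^4 \<le> n^2 * tr1 * tr3\<close>, and a factor \<open>tr1\<close> cancels.\<close>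

lemma tr3_ge_tr1: "tr1 ^ 3 / (real (card A))\<^sup>2 \<le> tr3"
proof (cases "tr1 = 0")
  case True
  thus ?thesis using tr3_nonneg by simp
next
  case False
  hence pos: "0 < tr1" using tr1_nonneg by simp
  have "tr1 * tr1 ^ 3 = (tr1\<^sup>2)\<^sup>2" by (simp add: power2_eq_square power3_eq_cube)
  also have "\<dots> \<le> (real (card A) * tr2)\<^sup>2" by (intro power_mono tr1_power2_le) simp
  also have "\<dots> = (real (card A))\<^sup>2 * tr2\<^sup>2" by (simp add: power_mult_distrib)
  also have "\<dots> \<le> (real (card A))\<^sup>2 * (tr1 * tr3)"
    by (intro mult_left_mono tr2_power2_le) simp
  finally have "tr1 * tr1 ^ 3 \<le> tr1 * ((real (card A))\<^sup>2 * tr3)" by (simp add: mult_ac)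
  with pos have "tr1 ^ 3 \<le> (real (card A))\<^sup>2 * tr3" by simp
  thus ?thesis using card_pos by (simp add: field_simps)
qed

text \<open>Eliminating \<open>tr1\<close> instead gives \<open>tr2^4 \<le> n * tr2 * tr3^2\<close>
  with \<open>n = card A\<close>; cancel \<open>tr2\<close> and take square roots.\<close>

lemma tr3_ge_tr2: "tr2 powr (3 / 2) / real (card A) powr (1 / 2) \<le> tr3"
proof (cases "tr2 = 0")
  case True
  thus ?thesis using tr3_nonneg by simp
next
  case False
  hence pos: "0 < tr2" using tr2_nonneg by simp
  have sqrt_sq: "(sqrt tr2 ^ 3)\<^sup>2 = tr2 ^ 3"
    using pos by (simp add: power3_eq_cube power2_eq_square power_mult_distrib)
  have "tr2 * tr2 ^ 3 = (tr2\<^sup>2)\<^sup>2" by (simp add: power2_eq_square power3_eq_cube)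
  also have "\<dots> \<le> (tr1 * tr3)\<^sup>2" by (intro power_mono tr2_power2_le) simp
  also have "\<dots> = tr1\<^sup>2 * tr3\<^sup>2" by (simp add: power_mult_distrib)
  also have "\<dots> \<le> real (card A) * tr2 * tr3\<^sup>2"
    by (intro mult_right_mono tr1_power2_le) simp
  finally have "tr2 * tr2 ^ 3 \<le> tr2 * (real (card A) * tr3\<^sup>2)" by (simp add: mult_ac)
  with pos have "tr2 ^ 3 \<le> real (card A) * tr3\<^sup>2" by simp
  hence "(sqrt tr2 ^ 3)\<^sup>2 \<le> (sqrt (card A) * tr3)\<^sup>2"
    unfolding sqrt_sq by (simp add: power_mult_distrib)
  hence "sqrt tr2 ^ 3 \<le> sqrt (card A) * tr3"
    by (rule power2_le_imp_le) (simp add: tr3_nonneg)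
  moreover have "tr2 powr (3 / 2) = sqrt tr2 ^ 3"
    using pos by (simp add: powr_half_sqrt[symmetric] powr_powr flip: powr_realpow)
  moreover have "real (card A) powr (1 / 2) = sqrt (card A)"
    by (simp add: powr_half_sqrt)
  ultimately show ?thesis using card_pos by (simp add: field_simps)
qed

section \<open>The lower bound from the all-ones vector\<close>

lemma entry_sum_eq_form: "entry_sum = form (\<lambda>_. 1) (\<lambda>_. 1)"
  unfolding entry_sum_def form_def by simp

lemma app_sym: "(\<Sum>x\<in>A. u x * app v x) = (\<Sum>x\<in>A. app u x * v x)"
  using form_sym[of u v] unfolding form_eq_app by (simp add: mult.commute)

text \<open>The left side is \<open>1\<^sup>T M\<^sup>3 1\<close>. As \<open>P = M\<^sup>3\<close> is again positive semidefinite,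
  \<open>2 P x w \<le> P x x + P w w\<close>, and this is summed over \<open>x\<close> and \<open>w\<close>.\<close>
lemma form_app_one_le: "form (app (\<lambda>_. 1)) (app (\<lambda>_. 1)) \<le> real (card A) * tr3"
proof -
  have app1: "app (\<lambda>_. 1) = (\<lambda>y. \<Sum>x\<in>A. M x y)"
    unfolding app_def by (simp add: sym)
  have "form (app (\<lambda>_. 1)) (app (\<lambda>_. 1))
      = (\<Sum>y\<in>A. \<Sum>z\<in>A. \<Sum>x\<in>A. \<Sum>w\<in>A. M x y * M w z * M y z)"
    unfolding app1 form_def unfolding sum_product unfolding sum_distrib_right ..
  also have "\<dots> = (\<Sum>y\<in>A. \<Sum>x\<in>A. \<Sum>z\<in>A. \<Sum>w\<in>A. M x y * M w z * M y z)"
    by (intro sum.cong refl sum.swap)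
  also have "\<dots> = (\<Sum>x\<in>A. \<Sum>y\<in>A. \<Sum>w\<in>A. \<Sum>z\<in>A. M x y * M w z * M y z)"
    by (subst sum.swap) (intro sum.cong refl sum.swap)
  also have "\<dots> = (\<Sum>x\<in>A. \<Sum>w\<in>A. form (M x) (M w))"
    unfolding form_def by (intro sum.cong refl sum.swap)
  finally have eq: "form (app (\<lambda>_. 1)) (app (\<lambda>_. 1)) = (\<Sum>x\<in>A. \<Sum>w\<in>A. form (M x) (M w))" .
  have "2 * form (M x) (M w) \<le> form (M x) (M x) + form (M w) (M w)" for x w
    using form_nonneg[of "\<lambda>y. M x y + (- 1) * M w y"]
    by (subst (asm) form_add_scaled) simp
  hence "(\<Sum>x\<in>A. \<Sum>w\<in>A. 2 * form (M x) (M w))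
      \<le> (\<Sum>x\<in>A. \<Sum>w\<in>A. form (M x) (M x) + form (M w) (M w))"
    by (intro sum_mono)
  also have "\<dots> = 2 * (real (card A) * tr3)"
    unfolding tr3_eq_form by (simp add: sum.distrib sum_distrib_left)
  finally show ?thesis unfolding eq by (simp add: sum_distrib_left[symmetric])
qed

text \<open>For the all-ones vector \<open>e\<close>, the numbers \<open>entry_sum\<close>,
  \<open>?b\<close> and \<open>?c\<close> are the values at \<open>e\<close> of the quadratic forms
  of \<open>M\<close>, \<open>M^2\<close> and \<open>M^3\<close>. They satisfy
  \<open>entry_sum^2 \<le> ?n * ?b\<close> and \<open>?b^2 \<le> entry_sum * ?c\<close>, while
  \<open>?c \<le> ?n * tr3\<close>.\<close>

lemma tr3_ge_entry_sum: "entry_sum ^ 3 / real (card A) ^ 3 \<le> tr3"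
proof (cases "entry_sum = 0")
  case True
  thus ?thesis using tr3_nonneg by simp
next
  case False
  let ?n = "real (card A)" and ?one = "\<lambda>_::'a. 1::real"
  let ?b = "form ?one (app ?one)" and ?c = "form (app ?one) (app ?one)"
  have pos: "0 < entry_sum" using False form_nonneg[of ?one] by (simp add: entry_sum_eq_form)
  have b: "?b = (\<Sum>x\<in>A. (app ?one x)\<^sup>2)"
    unfolding form_eq_app using app_sym[of ?one "app ?one"] by (simp add: power2_eq_square)
  have "entry_sum\<^sup>2 \<le> (\<Sum>x\<in>A. 1\<^sup>2) * (\<Sum>x\<in>A. (app ?one x)\<^sup>2)"
    using Cauchy_Schwarz_ineq_sum[of ?one "app ?one" A]
    by (simp add: entry_sum_eq_form form_eq_app)
  hence t2: "entry_sum\<^sup>2 \<le> ?n * ?b" by (simp add: b)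
  have bc: "?b\<^sup>2 \<le> entry_sum * ?c"
    using sum_form_Cauchy_Schwarz[of "\<lambda>_. ?one" "\<lambda>_. app ?one" "{()}"]
    by (simp add: entry_sum_eq_form)
  have "entry_sum * entry_sum ^ 3 = (entry_sum\<^sup>2)\<^sup>2" by (simp add: power2_eq_square power3_eq_cube)
  also have "\<dots> \<le> (?n * ?b)\<^sup>2" by (intro power_mono t2) simp
  also have "\<dots> = ?n\<^sup>2 * ?b\<^sup>2" by (simp add: power_mult_distrib)
  also have "\<dots> \<le> ?n\<^sup>2 * (entry_sum * ?c)" by (intro mult_left_mono bc) simp
  also have "\<dots> \<le> ?n\<^sup>2 * (entry_sum * (?n * tr3))"
    using pos by (intro mult_left_mono form_app_one_le) auto
  finally have "entry_sum * entry_sum ^ 3 \<le> entry_sum * (?n ^ 3 * tr3)"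
    by (simp add: power2_eq_square power3_eq_cube mult_ac)
  with pos have "entry_sum ^ 3 \<le> ?n ^ 3 * tr3" by simp
  thus ?thesis using card_pos by (simp add: field_simps)
qed

end

subsection \<open>Characters of a finite abelian group\<close>

lemma sum_const_lessThan_add:
  fixes a :: "'a::comm_monoid_add" and m n :: nat
  shows "(\<Sum>i<m + n. a) = (\<Sum>i<m. a) + (\<Sum>i<n. a)"
  by (induct n) (simp_all add: ac_simps)

text \<open>Pigeonhole: two multiples of \<open>a\<close> coincide, and their difference is a
  vanishing multiple. The sum of \<open>n\<close> equal terms serves as the \<open>n\<close>-fold
  multiple.\<close>

lemma finite_group_torsion:
  fixes a :: "'a::{finite,ab_group_add}"
  obtains n :: nat where "0 < n" "(\<Sum>i<n. a) = 0"
proof -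
  have "\<not> inj (\<lambda>k::nat. \<Sum>i<k. a)"
    using finite_imageD[of "\<lambda>k::nat. \<Sum>i<k. a" UNIV] by auto
  then obtain j k :: nat where "j < k" and eq: "(\<Sum>i<j. a) = (\<Sum>i<k. a)"
    unfolding inj_def by (metis linorder_neqE_nat)
  then obtain d where "k = j + d" "0 < d" by (metis less_imp_add_positive)
  with eq that show thesis by (simp add: sum_const_lessThan_add)
qed

text \<open>For \<open>0 < k < n\<close> the root of unity differs from 1, since equality would
  force \<open>n\<close> to divide \<open>k\<close>; the geometric sum then vanishes.\<close>

lemma sum_powers_root_unity:
  fixes k n :: nat
  assumes "k < n"
  shows "(\<Sum>j<n. cis (2 * pi * real k / real n) ^ j) = (if k = 0 then of_nat n else 0)"
proof (cases "k = 0")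
  case False
  let ?w = "cis (2 * pi * real k / real n)"
  have "?w \<noteq> 1"
  proof
    assume "?w = 1"
    hence "cos (2 * pi * real k / real n) = 1" by (metis cis.sel(1) one_complex.sel(1))
    then obtain m :: int where "2 * pi * real k / real n = real_of_int m * 2 * pi"
      by (auto simp: cos_one_2pi_int)
    hence "real k = real_of_int m * real n" using assms by (simp add: field_simps)
    hence km: "int k = m * int n" by (metis of_int_eq_iff of_int_mult of_int_of_nat_eq)
    hence "n dvd k" by (metis dvd_triv_right int_dvd_int_iff)
    with False assms show False by (simp add: nat_dvd_not_less)
  qed
  moreover have "?w ^ n = 1"
    using assms by (simp add: Complex.DeMoivre cis_multiple_2pi)
  ultimately show ?thesis using False by (simp add: geometric_sum)
qed simp

text \<open>The translations commute and have finite order, so a function separating \<open>0\<close> and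
  \<open>x\<close> has a joint eigencomponent that does so as well.\<close>
lemma translation_eigenfunction:
  fixes x :: "'a::{finite,ab_group_add}"
  assumes "x \<noteq> 0"
  shows "\<exists>g :: 'a \<Rightarrow> complex. g x \<noteq> g 0 \<and> (\<forall>a\<in>F. \<exists>w. \<forall>y. g (y + a) = w * g y)"
proof (induction F rule: infinite_finite_induct)
  case (infinite F)
  thus ?case by simp
next
  case empty
  show ?case using assms by (intro exI[of _ "\<lambda>y. of_bool (y = x)"]) auto
next
  case (insert a F)
  then obtain g :: "'a \<Rightarrow> complex"
    where g: "g x \<noteq> g 0" and eig: "\<And>b. b \<in> F \<Longrightarrow> \<exists>w. \<forall>y. g (y + b) = w * g y" by blast
  obtain n :: nat where n: "0 < n" "(\<Sum>i<n. a) = 0" using finite_group_torsion .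
  define w where "w j = cis (2 * pi * real j / real n)" for j :: nat
  \<comment> \<open>Up to the factor \<open>n\<close>, this projects \<open>g\<close> onto the
    eigenspace of translation by \<open>a\<close> with eigenvalue \<open>w j\<close>.\<close>
  define h where "h j y = (\<Sum>k<n. w j ^ k * g (y - (\<Sum>i<k. a)))" for j y
  have w_n: "w j ^ n = 1" for j
    using n by (simp add: w_def Complex.DeMoivre cis_multiple_2pi)
  have w_swap: "w j ^ k = w k ^ j" for j k
    by (simp add: w_def Complex.DeMoivre mult_ac)
  \<comment> \<open>The components add up to \<open>n\<close> times \<open>g\<close>, so at least
    one of them still separates \<open>x\<close> from 0.\<close>
  have "(\<Sum>j<n. h j y) = of_nat n * g y" for y
  proof -
    have "(\<Sum>j<n. h j y) = (\<Sum>k<n. (\<Sum>j<n. w k ^ j) * g (y - (\<Sum>i<k. a)))"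
      unfolding h_def sum_distrib_right by (subst sum.swap) (simp add: w_swap)
    also have "\<dots> = (\<Sum>k<n. if k = 0 then of_nat n * g y else 0)"
      by (intro sum.cong refl) (simp add: w_def sum_powers_root_unity)
    also have "\<dots> = of_nat n * g y" using n by simp
    finally show ?thesis .
  qed
  hence "(\<Sum>j<n. h j x) \<noteq> (\<Sum>j<n. h j 0)" using g n by simp
  then obtain j where j: "h j x \<noteq> h j 0" by (meson sum.cong)
  have "h j (y + a) = w j * h j y" for y
  proof -
    define f where "f k = w j ^ k * g (y + a - (\<Sum>i<k. a))" for k
    \<comment> \<open>Both the power of \<open>w j\<close> and the multiple of \<open>a\<close> have
      period \<open>n\<close>, so the sum may be shifted cyclically.\<close>
    have "f n = f 0" using n w_n by (simp add: f_def)
    hence "(\<Sum>k<n. f k) = (\<Sum>k<n. f (Suc k))"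
      by (metis add.commute add_left_cancel sum.lessThan_Suc sum.lessThan_Suc_shift)
    also have "\<dots> = w j * h j y"
      unfolding h_def sum_distrib_left
      by (intro sum.cong refl) (simp add: f_def algebra_simps)
    finally show ?thesis by (simp add: h_def f_def)
  qed
  \<comment> \<open>Translations commute, so the projection keeps the eigenvalues already secured
    for \<open>F\<close>.\<close>
  moreover have "\<exists>v. \<forall>y. h j (y + b) = v * h j y" if b: "b \<in> F" for b
  proof -
    obtain v where v: "\<And>y. g (y + b) = v * g y" using eig[OF b] by blast
    have "g (y + b - c) = v * g (y - c)" for y c
      using v[of "y - c"] by (simp add: algebra_simps)
    hence "h j (y + b) = v * h j y" for y
      unfolding h_def sum_distrib_left by (simp add: mult_ac)
    thus ?thesis by blast
  qed
  ultimately show ?case using j by blast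
qed

lemma multiplicative_power:
  fixes f :: "'a::comm_monoid_add \<Rightarrow> 'b::monoid_mult" and n :: nat
  assumes "\<And>x y. f (x + y) = f x * f y" "f 0 = 1"
  shows "f (\<Sum>i<n. a) = f a ^ n"
  by (induction n) (simp_all add: assms power_Suc2 del: power_Suc)

lemma is_character_zero: "is_character \<xi> \<Longrightarrow> \<xi> 0 = 1"
  unfolding is_character_def
  by (metis add_0 mult_cancel_right1 norm_zero zero_neq_one)

lemma is_character_uminus: "is_character \<xi> \<Longrightarrow> \<xi> (- x) = cnj (\<xi> x)"
  using is_character_zero[of \<xi>] unfolding is_character_def
  by (metis add.right_inverse complex_norm_square mult.commute mult_cancel_left norm_one
      of_real_1 one_power2 zero_neq_one norm_zero)

lemma is_character_diff: "is_character \<xi> \<Longrightarrow> \<xi> (x - y) = \<xi> x * cnj (\<xi> y)"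
  using is_character_uminus[of \<xi> y] unfolding is_character_def
  by (metis diff_conv_add_uminus)

text \<open>The eigenvalues of a joint eigenfunction of all translations form a character: they
  multiply, and torsion makes them roots of unity. As \<open>g a = w a * g 0\<close>, separating
  \<open>x\<close> from 0 means \<open>w x \<noteq> 1\<close>.\<close>

lemma ex_nontrivial_character:
  fixes x :: "'a::{finite,ab_group_add}"
  assumes "x \<noteq> 0"
  obtains \<xi> where "is_character \<xi>" "\<xi> x \<noteq> 1"
proof -
  obtain g :: "'a \<Rightarrow> complex"
    where g: "g x \<noteq> g 0" and "\<forall>a\<in>UNIV. \<exists>w. \<forall>y. g (y + a) = w * g y"
    using translation_eigenfunction[OF assms, of UNIV] by blast
  then obtain w where w: "\<And>a y. g (y + a) = w a * g y" by (metis UNIV_I)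
  have gw: "g a = w a * g 0" for a using w[of 0 a] by simp
  have g0: "g 0 \<noteq> 0" using g gw[of x] by auto
  have mult: "w (a + b) = w a * w b" for a b
    using w[of a b] g0 by (simp add: gw[of a] gw[of "a + b"])
  have w0: "w 0 = 1" using gw[of 0] g0 by simp
  have "cmod (w a) = 1" for a
  proof -
    obtain n :: nat where n: "0 < n" "(\<Sum>i<n. a) = 0" using finite_group_torsion .
    have "w a ^ n = 1" using multiplicative_power[of w a n] mult w0 n by simp
    hence "cmod (w a) ^ n = 1" by (metis norm_one norm_power)
    thus ?thesis using n power_eq_imp_eq_base[of "cmod (w a)" n 1] by simp
  qed
  with mult have "is_character w" by (simp add: is_character_def)
  moreover have "w x \<noteq> 1" using g gw[of x] by auto
  ultimately show thesis using that by blast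
qed

text \<open>The values at \<open>a\<close> are roots of unity of an order depending only on
  \<open>a\<close>. Finiteness makes the number of characters a nonzero normalising factor, as
  \<open>card\<close> of an infinite set is 0.\<close>

lemma finite_characters: "finite {\<xi> :: 'a::{finite,ab_group_add} \<Rightarrow> complex. is_character \<xi>}"
proof -
  have "\<exists>n::nat>0. (\<Sum>i<n. a) = 0" for a :: 'a using finite_group_torsion[of a] by blast
  then obtain n :: "'a \<Rightarrow> nat" where n: "\<And>a. 0 < n a" "\<And>a. (\<Sum>i<n a. a) = 0" by metis
  have "\<xi> a ^ n a = 1" if "is_character \<xi>" for \<xi> and a :: 'a
    using multiplicative_power[of \<xi> a "n a"] that n[of a] is_character_zero[OF that]
    by (simp add: is_character_def)
  hence "{\<xi> :: 'a \<Rightarrow> complex. is_character \<xi>} \<subseteq> PiE UNIV (\<lambda>a. {z. z ^ n a = 1})"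
    by auto
  moreover have "finite (PiE UNIV (\<lambda>a. {z :: complex. z ^ n a = 1}))"
    using n by (intro finite_PiE) (auto intro: finite_nth_roots)
  ultimately show ?thesis by (rule finite_subset)
qed

lemma is_character_mult:
  "is_character \<xi> \<Longrightarrow> is_character \<eta> \<Longrightarrow> is_character (\<lambda>x. \<xi> x * \<eta> x)"
  by (simp add: is_character_def norm_mult)

lemma is_character_cnj: "is_character \<xi> \<Longrightarrow> is_character (\<lambda>x. cnj (\<xi> x))"
  by (simp add: is_character_def)

text \<open>Multiplication by a character \<open>\<eta>\<close> permutes the characters, so the sum
  equals \<open>\<eta> x\<close> times itself; choose \<open>\<eta> x \<noteq> 1\<close>.\<close>

lemma sum_characters:
  fixes x :: "'a::{finite,ab_group_add}"
  shows "(\<Sum>\<xi> | is_character \<xi>. \<xi> x) =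
    (if x = 0 then of_nat (card {\<xi> :: 'a \<Rightarrow> complex. is_character \<xi>}) else 0)"
proof (cases "x = 0")
  case True
  thus ?thesis by (simp add: is_character_zero)
next
  case False
  then obtain \<eta> where \<eta>: "is_character \<eta>" "\<eta> x \<noteq> 1" using ex_nontrivial_character by blast
  have inv: "\<eta> y * cnj (\<eta> y) = 1" for y
    using \<eta>(1) by (simp add: is_character_def complex_norm_square[symmetric])
  have "(\<Sum>\<xi> | is_character \<xi>. \<xi> x) = (\<Sum>\<xi> | is_character \<xi>. \<eta> x * \<xi> x)"
    by (rule sum.reindex_bij_witness[of _ "\<lambda>\<xi> y. \<eta> y * \<xi> y" "\<lambda>\<xi> y. cnj (\<eta> y) * \<xi> y"])
       (use \<eta> inv in \<open>auto intro!: is_character_mult is_character_cnj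
          simp: mult.assoc[symmetric] mult.commute[of "cnj _"]\<close>)
  also have "\<dots> = \<eta> x * (\<Sum>\<xi> | is_character \<xi>. \<xi> x)" by (simp add: sum_distrib_left)
  finally show ?thesis using \<eta>(2) False by simp
qed

lemma card_characters_pos: "0 < card {\<xi> :: 'a::{finite,ab_group_add} \<Rightarrow> complex. is_character \<xi>}"
proof -
  have "is_character (\<lambda>_::'a. 1)" by (simp add: is_character_def)
  thus ?thesis using finite_characters by (auto simp: card_gt_0_iff)
qed

section \<open>Fourier inversion and functions with nonnegative transform\<close>

lemma fourier_inversion:
  fixes \<psi> :: "'a::{finite,ab_group_add} \<Rightarrow> complex"
  shows "of_nat (card {\<xi> :: 'a \<Rightarrow> complex. is_character \<xi>}) * \<psi> x =
    (\<Sum>\<xi> | is_character \<xi>. fourier \<psi> \<xi> * \<xi> x)"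
proof -
  have "(\<Sum>\<xi> | is_character \<xi>. fourier \<psi> \<xi> * \<xi> x) =
      (\<Sum>\<xi> | is_character \<xi>. \<Sum>y\<in>UNIV. \<psi> y * \<xi> (x - y))"
    unfolding fourier_def sum_distrib_right
    by (intro sum.cong refl) (simp add: is_character_diff mult_ac)
  also have "\<dots> = (\<Sum>y\<in>UNIV. \<psi> y * (\<Sum>\<xi> | is_character \<xi>. \<xi> (x - y)))"
    by (subst sum.swap) (simp add: sum_distrib_left)
  also have "\<dots> = of_nat (card {\<xi> :: 'a \<Rightarrow> complex. is_character \<xi>}) * \<psi> x"
    by (simp add: sum_characters if_distrib cong: if_cong)
  finally show ?thesis by simp
qed

text \<open>Conjugating the inversion formula fixes the real coefficients and turns
  \<open>\<xi> x\<close> into \<open>\<xi> (- x)\<close>.\<close>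

lemma fourier_nonneg_imp_hermitian:
  fixes \<psi> :: "'a::{finite,ab_group_add} \<Rightarrow> complex"
  assumes "\<And>\<xi>. is_character \<xi> \<Longrightarrow> fourier \<psi> \<xi> \<in> \<real>\<^sub>\<ge>\<^sub>0"
  shows "cnj (\<psi> x) = \<psi> (- x)"
proof -
  let ?C = "{\<xi> :: 'a \<Rightarrow> complex. is_character \<xi>}"
  have real: "cnj (fourier \<psi> \<xi>) = fourier \<psi> \<xi>" if "is_character \<xi>" for \<xi>
    using assms[OF that] by (auto elim!: nonneg_Reals_cases)
  have "of_nat (card ?C) * cnj (\<psi> x) = cnj (of_nat (card ?C) * \<psi> x)" by simp
  also have "\<dots> = of_nat (card ?C) * \<psi> (- x)"
    unfolding fourier_inversion cnj_sum
    by (intro sum.cong refl) (simp add: real is_character_uminus)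
  finally show ?thesis using card_characters_pos[where 'a = 'a] by simp
qed

text \<open>Inversion diagonalises the quadratic form: up to the number of characters it is the sum
  of \<open>fourier \<psi> \<xi>\<close> times the squared modulus of
  \<open>s \<xi>\<close>.\<close>

lemma fourier_nonneg_imp_psd:
  fixes \<psi> :: "'a::{finite,ab_group_add} \<Rightarrow> complex" and u :: "'a \<Rightarrow> real"
  assumes "\<And>\<xi>. is_character \<xi> \<Longrightarrow> fourier \<psi> \<xi> \<in> \<real>\<^sub>\<ge>\<^sub>0"
  shows "0 \<le> (\<Sum>x\<in>A. \<Sum>y\<in>A. u x * u y * Re (\<psi> (x - y)))"
proof -
  let ?C = "{\<xi> :: 'a \<Rightarrow> complex. is_character \<xi>}"
  define s where "s \<xi> = (\<Sum>x\<in>A. of_real (u x) * \<xi> x)" for \<xi> :: "'a \<Rightarrow> complex"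
  have "of_nat (card ?C) * (\<Sum>x\<in>A. \<Sum>y\<in>A. of_real (u x * u y) * \<psi> (x - y)) =
      (\<Sum>x\<in>A. \<Sum>y\<in>A. of_real (u x * u y) * (of_nat (card ?C) * \<psi> (x - y)))"
    by (simp add: sum_distrib_left mult_ac)
  also have "\<dots> = (\<Sum>x\<in>A. \<Sum>y\<in>A. \<Sum>\<xi>\<in>?C.
      fourier \<psi> \<xi> * ((of_real (u x) * \<xi> x) * cnj (of_real (u y) * \<xi> y)))"
    unfolding fourier_inversion sum_distrib_left
    by (intro sum.cong refl) (simp add: is_character_diff mult_ac)
  also have "\<dots> = (\<Sum>\<xi>\<in>?C. \<Sum>x\<in>A. \<Sum>y\<in>A.
      fourier \<psi> \<xi> * ((of_real (u x) * \<xi> x) * cnj (of_real (u y) * \<xi> y)))"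
    by (subst sum.swap[of _ ?C]) (intro sum.cong refl sum.swap)
  also have "\<dots> = (\<Sum>\<xi>\<in>?C. fourier \<psi> \<xi> * (s \<xi> * cnj (s \<xi>)))"
    unfolding s_def cnj_sum sum_product by (simp add: sum_distrib_left)
  finally have "Re (of_nat (card ?C) * (\<Sum>x\<in>A. \<Sum>y\<in>A. of_real (u x * u y) * \<psi> (x - y)))
      = Re (\<Sum>\<xi>\<in>?C. fourier \<psi> \<xi> * (s \<xi> * cnj (s \<xi>)))"
    by (rule arg_cong)
  hence "real (card ?C) * (\<Sum>x\<in>A. \<Sum>y\<in>A. u x * u y * Re (\<psi> (x - y)))
      = (\<Sum>\<xi>\<in>?C. Re (fourier \<psi> \<xi> * (s \<xi> * cnj (s \<xi>))))"
    by simp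
  also have "\<dots> \<ge> 0"
  proof (intro sum_nonneg)
    fix \<xi> assume "\<xi> \<in> ?C"
    then obtain r where "fourier \<psi> \<xi> = of_real r" "0 \<le> r"
      using assms[of \<xi>] by (auto elim!: nonneg_Reals_cases)
    thus "0 \<le> Re (fourier \<psi> \<xi> * (s \<xi> * cnj (s \<xi>)))"
      by (simp add: complex_norm_square[symmetric])
  qed
  finally show ?thesis
    using card_characters_pos[where 'a = 'a] by (simp add: zero_le_mult_iff)
qed

text \<open>Turns sums weighted by difference counts into sums over the entries of a kernel on
  \<open>A\<close>.\<close>

lemma sum_diff_count:
  fixes A :: "'a::{finite,ab_group_add} set" and f :: "'a \<Rightarrow> 'b::comm_semiring_1"
  shows "(\<Sum>x\<in>UNIV. f x * of_nat (diff_count A x)) = (\<Sum>a\<in>A. \<Sum>b\<in>A. f (b - a))"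
proof -
  have "of_nat (diff_count A x) = (\<Sum>a\<in>A. \<Sum>b\<in>A. of_bool (b - a = x) :: 'b)" for x
  proof -
    have "(\<Sum>a\<in>A. \<Sum>b\<in>A. of_bool (b - a = x) :: 'b)
        = of_nat (card ((A \<times> A) \<inter> {p. snd p - fst p = x}))"
      unfolding sum.cartesian_product case_prod_beta by (simp add: sum_of_bool_eq)
    also have "(A \<times> A) \<inter> {p. snd p - fst p = x} = {(a, b). a \<in> A \<and> b \<in> A \<and> b - a = x}"
      by auto
    finally show ?thesis by (simp add: diff_count_def)
  qed
  hence "(\<Sum>x\<in>UNIV. f x * of_nat (diff_count A x))
      = (\<Sum>x\<in>UNIV. \<Sum>a\<in>A. \<Sum>b\<in>A. f x * of_bool (b - a = x))"
    by (simp only: sum_distrib_left)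
  also have "\<dots> = (\<Sum>a\<in>A. \<Sum>b\<in>A. \<Sum>x\<in>UNIV. f x * of_bool (b - a = x))"
    by (subst sum.swap) (intro sum.cong refl sum.swap)
  also have "\<dots> = (\<Sum>a\<in>A. \<Sum>b\<in>A. f (b - a))"
    by (simp add: of_bool_def if_distrib cong: if_cong)
  finally show ?thesis .
qed

subsection \<open>The trace inequality\<close>

theorem proposition28:
  fixes A :: "'a::{finite,ab_group_add} set"
    and \<psi> :: "'a \<Rightarrow> complex"
  assumes "A \<noteq> {}"
    and "\<And>x. \<psi> (- x) = \<psi> x"
    and "\<And>\<xi>. is_character \<xi> \<Longrightarrow> fourier \<psi> \<xi> \<in> \<real>\<^sub>\<ge>\<^sub>0"
  shows "let S = (\<Sum>x\<in>A. \<Sum>y\<in>A. \<Sum>z\<in>A. \<psi> (x - y) * cnj (\<psi> (x - z)) * \<psi> (y - z));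
             T = (\<Sum>x\<in>UNIV. \<psi> x * of_nat (diff_count A x))
         in S \<in> \<real> \<and> T \<in> \<real> \<and>
            Re S \<ge> Max {1 / real (card A) ^ 3 * Re T ^ 3,
                        cmod (\<psi> 0) ^ 3 * real (card A),
                        1 / real (card A) powr (1 / 2) *
                          (\<Sum>x\<in>UNIV. (cmod (\<psi> x))\<^sup>2 * real (diff_count A x)) powr (3 / 2)}"
proof -
  define \<phi> where "\<phi> x = Re (\<psi> x)" for x
  have "cnj (\<psi> x) = \<psi> x" for x
    using fourier_nonneg_imp_hermitian[OF assms(3)] assms(2) by simp
  hence \<psi>: "\<psi> x = of_real (\<phi> x)" for x
    unfolding \<phi>_def by (metis Reals_cnj_iff of_real_Re)
  have \<phi>_minus: "\<phi> (y - x) = \<phi> (x - y)" for x y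
    unfolding \<phi>_def using assms(2)[of "x - y"] by simp
  interpret psd_kernel A "\<lambda>x y. \<phi> (x - y)"
  proof
    show "0 \<le> (\<Sum>x\<in>A. \<Sum>y\<in>A. u x * u y * \<phi> (x - y))" for u
      unfolding \<phi>_def using assms(3) by (rule fourier_nonneg_imp_psd)
  qed (use assms(1) \<phi>_minus in auto)
  have S: "(\<Sum>x\<in>A. \<Sum>y\<in>A. \<Sum>z\<in>A. \<psi> (x - y) * cnj (\<psi> (x - z)) * \<psi> (y - z)) = of_real tr3"
    unfolding tr3_def by (simp add: \<psi>)
  have T: "(\<Sum>x\<in>UNIV. \<psi> x * of_nat (diff_count A x)) = of_real entry_sum"
    unfolding entry_sum_def sum_diff_count by (simp add: \<psi> \<phi>_minus)
  have U: "(\<Sum>x\<in>UNIV. (cmod (\<psi> x))\<^sup>2 * real (diff_count A x)) = tr2"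
    unfolding tr2_def sum_diff_count by (subst sum.swap) (simp add: \<psi>)
  have tr1: "tr1 = real (card A) * \<phi> 0"
    by (simp add: tr1_def)
  \<comment> \<open>The constant diagonal makes \<open>\<phi> 0\<close> the mean of a nonnegative
    trace, so \<open>cmod (\<psi> 0)\<close> is \<open>\<phi> 0\<close> itself.\<close>
  have "0 \<le> \<phi> 0"
    using tr1_nonneg card_pos unfolding tr1 by (metis mult_le_cancel_left_pos mult_zero_right)
  hence V: "cmod (\<psi> 0) ^ 3 * real (card A) = tr1 ^ 3 / (real (card A))\<^sup>2"
    using card_pos by (simp add: \<psi> tr1 power2_eq_square power3_eq_cube)
  show ?thesis
    unfolding Let_def S T U V
    using tr3_ge_entry_sum tr3_ge_tr1 tr3_ge_tr2 by simp
qed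

end
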